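(* Let $t\ge 1$ and let $l_1,\dots,l_t$ be positive integers with $l_1\ge 2$ and $l_t\ge 2$. Then the generalized zigzag graph $GZZ(l_1,\dots,l_t)$ is primitively log divergent.
   Context: Generalized zigzag graph $GZZ(l_1,\dots,l_t)$: start with vertices $u_1,\dots,u_{t+2}$ and edges $(u_i,u_{i+1})$ for $1\le i\le t+1$. For each $1\le i\le t$ add $l_i-1$ new vertices $v_{i1},\dots,v_{i,l_i-1}$, the $l_i$ edges of the path $u_i,v_{i1},\dots,v_{i,l_i-1},u_{i+2}$ (if $l_i=1$ this is the single edge $(u_i,u_{i+2})$), and the $l_i-1$ edges $(v_{ij},u_{i+1})$, $1\le j\le l_i-1$. Finally add the edge $(u_1,u_{t+2})$. For a finite graph $\Gamma$ let $h_1(\Gamma)=\mathrm{rank}\,H_1(\Gamma,\mathbb{Z})$. $\Gamma$ is convergent if $|E(\Gamma)|>2h_1(\Gamma)$, and logarithmically divergent if $|E(\Gamma)|=2h_1(\Gamma)$. A logarithmically divergent graph $\Gamma$ is primitively log divergent if every connected proper subgraph $\Gamma'\subset\Gamma$ (determined by its nonempty set of edges, a proper subset of the edges of $\Gamma$) is convergent. *)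

theory Defs
  imports
    "Graph_Theory.Digraph"
    "Graph_Theory.Digraph_Component"
    "HOL-Library.Poly_Mapping"
begin

text \<open>
  A finite undirected multigraph is represented by a \<^typ>\<open>('v, 'e) pre_digraph\<close> having exactly one
  arc per edge, i.e. by a choice of orientation.  The orientation only enters the signs of the
  boundary map below, and \<^const>\<open>Digraph_Component.connected\<close> means connectedness of the underlying
  undirected graph.
\<close>

definition boundary :: "('v, 'e) pre_digraph \<Rightarrow> ('e \<Rightarrow>\<^sub>0 int) \<Rightarrow> ('v \<Rightarrow>\<^sub>0 int)" where
  "boundary G = frag_extend (\<lambda>e. frag_of (head G e) - frag_of (tail G e))"

text \<open>A graph has no cells of dimension 2, so its first homology group is the group of 1-cycles.\<close>

definition H1 :: "('v, 'e) pre_digraph \<Rightarrow> ('e \<Rightarrow>\<^sub>0 int) set" where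
  "H1 G = {c. Poly_Mapping.keys c \<subseteq> arcs G \<and> boundary G c = 0}"

lemma module_frag_cmul: "module (frag_cmul :: int \<Rightarrow> ('a \<Rightarrow>\<^sub>0 int) \<Rightarrow> _)"
  by unfold_locales (simp_all add: frag_cmul_distrib frag_cmul_distrib2)

text \<open>
  Rank of an abelian group: the maximal number of elements linearly independent over the integers.
  The supremum is meaningful for groups of finite rank only.
\<close>

definition Z_rank :: "('a \<Rightarrow>\<^sub>0 int) set \<Rightarrow> nat" where
  "Z_rank A = Sup {card B |B. finite B \<and> B \<subseteq> A \<and> \<not> module.dependent frag_cmul B}"

definition h1 :: "('v, 'e) pre_digraph \<Rightarrow> nat" where
  "h1 G = Z_rank (H1 G)"

definition convergent_graph :: "('v, 'e) pre_digraph \<Rightarrow> bool" where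
  "convergent_graph G \<longleftrightarrow> card (arcs G) > 2 * h1 G"

definition log_divergent :: "('v, 'e) pre_digraph \<Rightarrow> bool" where
  "log_divergent G \<longleftrightarrow> card (arcs G) = 2 * h1 G"

definition edge_subgraph :: "('v, 'e) pre_digraph \<Rightarrow> 'e set \<Rightarrow> ('v, 'e) pre_digraph" where
  "edge_subgraph G A = \<lparr>verts = tail G ` A \<union> head G ` A, arcs = A, tail = tail G, head = head G\<rparr>"

definition primitively_log_divergent :: "('v, 'e) pre_digraph \<Rightarrow> bool" where
  "primitively_log_divergent G \<longleftrightarrow>
     log_divergent G \<and>
     (\<forall>A. A \<noteq> {} \<and> A \<subset> arcs G \<and> Digraph_Component.connected (edge_subgraph G A)
        \<longrightarrow> convergent_graph (edge_subgraph G A))"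

datatype gzz_vertex = U nat | V nat nat

text \<open>
  \<open>Spine i\<close> is the edge \<open>(u\<^sub>i, u\<^sub>i\<^sub>+\<^sub>1)\<close>, \<open>Side i j\<close> the edge number \<open>j\<close> (from 0) of the path
  from \<open>u\<^sub>i\<close> to \<open>u\<^sub>i\<^sub>+\<^sub>2\<close>, \<open>Spoke i j\<close> the edge \<open>(v\<^sub>i\<^sub>j, u\<^sub>i\<^sub>+\<^sub>1)\<close>, and \<open>Closing\<close> the edge
  \<open>(u\<^sub>1, u\<^sub>t\<^sub>+\<^sub>2)\<close>.
\<close>

datatype gzz_edge = Spine nat | Side nat nat | Spoke nat nat | Closing

definition side_vertex :: "(nat \<Rightarrow> nat) \<Rightarrow> nat \<Rightarrow> nat \<Rightarrow> gzz_vertex" where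
  "side_vertex l i j = (if j = 0 then U i else if j = l i then U (i + 2) else V i j)"

fun gzz_tail :: "(nat \<Rightarrow> nat) \<Rightarrow> gzz_edge \<Rightarrow> gzz_vertex" where
  "gzz_tail l (Spine i) = U i"
| "gzz_tail l (Side i j) = side_vertex l i j"
| "gzz_tail l (Spoke i j) = V i j"
| "gzz_tail l Closing = U 1"

fun gzz_head :: "nat \<Rightarrow> (nat \<Rightarrow> nat) \<Rightarrow> gzz_edge \<Rightarrow> gzz_vertex" where
  "gzz_head t l (Spine i) = U (i + 1)"
| "gzz_head t l (Side i j) = side_vertex l i (j + 1)"
| "gzz_head t l (Spoke i j) = U (i + 1)"
| "gzz_head t l Closing = U (t + 2)"

definition GZZ :: "nat \<Rightarrow> (nat \<Rightarrow> nat) \<Rightarrow> (gzz_vertex, gzz_edge) pre_digraph" where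
  "GZZ t l = \<lparr>
     verts = U ` {1..t + 2} \<union> {V i j |i j. i \<in> {1..t} \<and> j \<in> {1..<l i}},
     arcs = Spine ` {1..t + 1}
          \<union> {Side i j |i j. i \<in> {1..t} \<and> j \<in> {0..<l i}}
          \<union> {Spoke i j |i j. i \<in> {1..t} \<and> j \<in> {1..<l i}}
          \<union> {Closing},
     tail = gzz_tail l,
     head = gzz_head t l\<rparr>"

lemma fin_digraph_GZZ: "fin_digraph (GZZ t l)"
proof
  have "{V i j |i j. i \<in> {1..t} \<and> j \<in> {1..<l i}} = (\<Union>i\<in>{1..t}. V i ` {1..<l i})"
    by auto
  then show "finite (verts (GZZ t l))"
    by (simp add: GZZ_def)
  have "{Side i j |i j. i \<in> {1..t} \<and> j \<in> {0..<l i}} = (\<Union>i\<in>{1..t}. Side i ` {0..<l i})"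
       "{Spoke i j |i j. i \<in> {1..t} \<and> j \<in> {1..<l i}} = (\<Union>i\<in>{1..t}. Spoke i ` {1..<l i})"
    by auto
  then show "finite (arcs (GZZ t l))"
    by (simp add: GZZ_def)
qed (auto simp: GZZ_def side_vertex_def)

end

theory Submission
  imports Defs "HOL-Library.Product_Lexorder"
begin

text \<open>
  By Euler's formula a connected graph with \<open>n\<close> vertices and \<open>m\<close> edges has \<open>h\<^sub>1 = m - n + 1\<close>, so it is
  logarithmically divergent iff \<open>m = 2n - 2\<close> and convergent iff \<open>m \<le> 2n - 3\<close>.  Without the closing
  edge, the zigzag graph is built by attaching each new vertex to two earlier ones, so its subgraphs
  all satisfy \<open>m \<le> 2n - 3\<close>.  A subgraph that contains the closing edge and violates this bound must
  contain both earlier neighbours of each of its vertices after the second; descending from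
  \<open>u\<^sub>t\<^sub>+\<^sub>2\<close> it is then the whole graph.
\<close>

section \<open>The Euler formula for the rank of the first homology\<close>

text \<open>Gaussian elimination without division: one unknown is removed by cross-multiplying with
  a nonzero pivot, so all coefficients stay integral. This will bound the rank of \<open>H1\<close>
  from above.\<close>

lemma homogeneous_system_nontrivial_solution:
  fixes M :: "'b \<Rightarrow> 's \<Rightarrow> int"
  assumes "finite S" "finite B" "card S < card B"
  shows "\<exists>a. (\<exists>b\<in>B. a b \<noteq> 0) \<and> (\<forall>s\<in>S. (\<Sum>b\<in>B. a b * M b s) = 0)"
  using assms
proof (induction S arbitrary: B M rule: finite_induct)
  case empty
  then have "B \<noteq> {}" by auto
  then show ?case by (intro exI[of _ "\<lambda>_. 1"]) auto
next
  case (insert s S)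
  show ?case
  proof (cases "\<forall>b\<in>B. M b s = 0")
    case True
    have "card S < card B" using insert by simp
    from insert.IH[OF \<open>finite B\<close> this, of M] True show ?thesis by auto
  next
    case False
    then obtain b0 where b0: "b0 \<in> B" "M b0 s \<noteq> 0" by blast
    define B' where "B' = B - {b0}"
    have B: "B = insert b0 B'" "b0 \<notin> B'" "finite B'"
      using b0 insert.prems by (auto simp: B'_def)
    have "card S < card B'" using insert B by simp
    from insert.IH[OF \<open>finite B'\<close> this, of "\<lambda>b s'. M b0 s * M b s' - M b s * M b0 s'"]
    obtain a where a: "\<exists>b\<in>B'. a b \<noteq> 0"
      and sol: "\<And>s'. s' \<in> S \<Longrightarrow> (\<Sum>b\<in>B'. a b * (M b0 s * M b s' - M b s * M b0 s')) = 0"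
      by blast
    \<comment> \<open>The values on \<open>B'\<close> are scaled by the pivot, hence stay
      nontrivial; the value at \<open>b0\<close> is then chosen so that equation \<open>s\<close>
      holds.\<close>
    define a' where "a' = (\<lambda>b. if b = b0 then - (\<Sum>b\<in>B'. a b * M b s) else a b * M b0 s)"
    have sum_a': "(\<Sum>b\<in>B. a' b * M b s')
        = (\<Sum>b\<in>B'. a b * (M b0 s * M b s' - M b s * M b0 s'))" for s'
    proof -
      have "(\<Sum>b\<in>B'. a' b * M b s') = (\<Sum>b\<in>B'. a b * M b0 s * M b s')"
        using B by (intro sum.cong) (auto simp: a'_def)
      then show ?thesis
        using B by (simp add: a'_def algebra_simps sum_subtractf sum_distrib_left)
    qed
    have "(\<Sum>b\<in>B. a' b * M b s') = 0" if "s' \<in> insert s S" for s'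
      using that sol by (auto simp: sum_a' mult.commute)
    moreover have "\<exists>b\<in>B. a' b \<noteq> 0"
      using a b0 B by (auto simp: a'_def)
    ultimately show ?thesis by blast
  qed
qed

section \<open>Coefficients and linearity of the boundary map\<close>

lemma lookup_frag_sum:
  "poly_mapping.lookup (sum f A) x = (\<Sum>a\<in>A. poly_mapping.lookup (f a) x)"
  by (induction A rule: infinite_finite_induct) (auto simp: lookup_add)

lemma lookup_boundary:
  assumes "finite S" "Poly_Mapping.keys c \<subseteq> S"
  shows "poly_mapping.lookup (boundary G c) v
       = (\<Sum>e\<in>S. poly_mapping.lookup c e * (of_bool (head G e = v) - of_bool (tail G e = v)))"
proof -
  have "poly_mapping.lookup (boundary G c) v
      = (\<Sum>e\<in>Poly_Mapping.keys c.
           poly_mapping.lookup c e * (of_bool (head G e = v) - of_bool (tail G e = v)))"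
    unfolding boundary_def frag_extend_def lookup_frag_sum
    by (intro sum.cong) (auto simp: lookup_minus)
  also have "\<dots> = (\<Sum>e\<in>S. poly_mapping.lookup c e
                     * (of_bool (head G e = v) - of_bool (tail G e = v)))"
    using assms by (intro sum.mono_neutral_left) (auto simp: in_keys_iff)
  finally show ?thesis .
qed

lemma boundary_simps [simp]:
  "boundary G 0 = 0"
  "boundary G (frag_of e) = frag_of (head G e) - frag_of (tail G e)"
  "boundary G (c + d) = boundary G c + boundary G d"
  "boundary G (c - d) = boundary G c - boundary G d"
  "boundary G (- c) = - boundary G c"
  "boundary G (frag_cmul k c) = frag_cmul k (boundary G c)"
  by (simp_all add: boundary_def frag_extend_add frag_extend_diff frag_extend_minus
      frag_extend_cmul)

lemma boundary_sum: "boundary G (sum f A) = (\<Sum>a\<in>A. boundary G (f a))"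
  by (induction A rule: infinite_finite_induct) auto

text \<open>
  Connectedness enters through the cut condition: every proper nonempty vertex set is left by
  some edge.  The spanning tree is grown one vertex at a time along such edges.
\<close>

lemma spanning_tree_exists:
  assumes G: "fin_digraph G" and ne: "verts G \<noteq> {}"
    and cut: "\<And>W. W \<noteq> {} \<Longrightarrow> W \<subset> verts G \<Longrightarrow> \<exists>e\<in>arcs G. (tail G e \<in> W) \<noteq> (head G e \<in> W)"
  obtains F where "F \<subseteq> arcs G" "card F + 1 = card (verts G)"
    "\<And>c. Poly_Mapping.keys c \<subseteq> F \<Longrightarrow> boundary G c = 0 \<Longrightarrow> c = 0"
    "\<And>u v. u \<in> verts G \<Longrightarrow> v \<in> verts G \<Longrightarrow>
       \<exists>p. Poly_Mapping.keys p \<subseteq> F \<and> boundary G p = frag_of v - frag_of u"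
proof -
  interpret fin_digraph G by (rule G)
  obtain r where r: "r \<in> verts G" using ne by blast
  \<comment> \<open>\<open>F\<close> is a tree on \<open>W\<close> with root \<open>r\<close>,
    expressed through chains: acyclic means that no nonzero cycle is supported on \<open>F\<close>,
    connected means that each vertex of \<open>W\<close> is joined to \<open>r\<close> by a chain on
    \<open>F\<close>.\<close>
  define Q where "Q W F \<longleftrightarrow> r \<in> W \<and> W \<subseteq> verts G \<and> F \<subseteq> arcs G \<and> card F + 1 = card W
      \<and> tail G ` F \<subseteq> W \<and> head G ` F \<subseteq> W
      \<and> (\<forall>c. Poly_Mapping.keys c \<subseteq> F \<longrightarrow> boundary G c = 0 \<longrightarrow> c = 0)
      \<and> (\<forall>v\<in>W. \<exists>p. Poly_Mapping.keys p \<subseteq> F \<and> boundary G p = frag_of v - frag_of r)" for W F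
  have "\<exists>W F. card W = n \<and> Q W F" if "1 \<le> n" "n \<le> card (verts G)" for n
    using that
  proof (induction n rule: dec_induct)
    case base
    have "Q {r} {}"
      using r by (auto simp: Q_def intro: exI[of _ 0])
    then show ?case by (intro exI[of _ "{r}"] exI[of _ "{}"]) simp
  next
    case (step n)
    then obtain W F where W: "card W = n" "Q W F" by auto
    have paths: "\<exists>p. Poly_Mapping.keys p \<subseteq> F \<and> boundary G p = frag_of v - frag_of r"
      if "v \<in> W" for v
      using W that unfolding Q_def by simp
    from W have finF: "finite F" and finW: "finite W"
      by (auto simp: Q_def intro: finite_subset[OF _ finite_arcs] finite_subset[OF _ finite_verts])
    have "W \<subset> verts G" using W step.prems by (auto simp: Q_def)
    moreover have "W \<noteq> {}" using W by (auto simp: Q_def)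
    ultimately obtain e where e: "e \<in> arcs G" "(tail G e \<in> W) \<noteq> (head G e \<in> W)"
      using cut by blast
    define a where "a = (if tail G e \<in> W then tail G e else head G e)"
    define b where "b = (if tail G e \<in> W then head G e else tail G e)"
    define q where "q = (if tail G e \<in> W then frag_of e else - frag_of e)"
    have ab: "a \<in> W" "b \<notin> W" "b \<in> verts G" "tail G e \<in> insert b W" "head G e \<in> insert b W"
      using e by (auto simp: a_def b_def)
    have q: "Poly_Mapping.keys q = {e}" "boundary G q = frag_of b - frag_of a"
      by (auto simp: q_def a_def b_def keys_frag_of)
    have eF: "e \<notin> F" using W e by (auto simp: Q_def)
    \<comment> \<open>Among the arcs in \<open>insert e F\<close> only \<open>e\<close> meets
      \<open>b\<close>, so the boundary coefficient at \<open>b\<close> forces \<open>c\<close> to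
      vanish on \<open>e\<close>.\<close>
    have "c = 0" if c: "Poly_Mapping.keys c \<subseteq> insert e F" "boundary G c = 0" for c
    proof -
      have "0 = (\<Sum>x\<in>insert e F. poly_mapping.lookup c x
                * (of_bool (head G x = b) - of_bool (tail G x = b)))"
        using lookup_boundary[of "insert e F" c G b] c finF by simp
      also have "\<dots> = poly_mapping.lookup c e * (of_bool (head G e = b) - of_bool (tail G e = b))
          + (\<Sum>x\<in>F. 0)"
        unfolding sum.insert[OF finF eF]
        using W ab(2) by (intro arg_cong2[where f = "(+)"] refl sum.cong) (auto simp: Q_def)
      finally have "poly_mapping.lookup c e = 0"
        using e ab by (auto simp: a_def b_def split: if_splits)
      then have "Poly_Mapping.keys c \<subseteq> F"
        using c by (auto simp: in_keys_iff)
      then show ?thesis using W c by (auto simp: Q_def)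
    qed
    moreover have "\<exists>p. Poly_Mapping.keys p \<subseteq> insert e F \<and> boundary G p = frag_of v - frag_of r"
      if v: "v \<in> insert b W" for v
    proof (cases "v = b")
      case True
      obtain p where p: "Poly_Mapping.keys p \<subseteq> F" "boundary G p = frag_of a - frag_of r"
        using paths ab by blast
      have "Poly_Mapping.keys (p + q) \<subseteq> insert e F"
        using p q Poly_Mapping.keys_add[of p q] by auto
      then show ?thesis using p q True by (intro exI[of _ "p + q"]) simp
    next
      case False
      then obtain p where "Poly_Mapping.keys p \<subseteq> F" "boundary G p = frag_of v - frag_of r"
        using v paths by blast
      then show ?thesis by (intro exI[of _ p]) auto
    qed
    ultimately have "Q (insert b W) (insert e F)"
      using W e ab eF finF finW unfolding Q_def by (intro conjI allI ballI impI) auto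
    then show ?case using W ab finW by (intro exI[of _ "insert b W"] exI[of _ "insert e F"]) simp
  qed
  moreover have "1 \<le> card (verts G)"
    using ne by (simp add: Suc_leI card_gt_0_iff)
  ultimately obtain W F where W: "card W = card (verts G)" "Q W F" by blast
  then have "W = verts G" by (intro card_subset_eq) (simp_all add: Q_def)
  show ?thesis
  proof
    show "F \<subseteq> arcs G" "card F + 1 = card (verts G)"
      "\<And>c. Poly_Mapping.keys c \<subseteq> F \<Longrightarrow> boundary G c = 0 \<Longrightarrow> c = 0"
      using W by (auto simp: Q_def)
    fix u v assume "u \<in> verts G" "v \<in> verts G"
    then obtain p p' where "Poly_Mapping.keys p \<subseteq> F" "boundary G p = frag_of v - frag_of r"
      "Poly_Mapping.keys p' \<subseteq> F" "boundary G p' = frag_of u - frag_of r"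
      using W \<open>W = verts G\<close> unfolding Q_def by meson
    then show "\<exists>p. Poly_Mapping.keys p \<subseteq> F \<and> boundary G p = frag_of v - frag_of u"
      using Poly_Mapping.keys_diff[of p p'] by (intro exI[of _ "p - p'"]) auto
  qed
qed

text \<open>The arcs outside a spanning tree, the chords, number m - n + 1. Their fundamental cycles
  are independent, since each chord occurs in its own cycle only. Conversely, a cycle with no chord
  lies on the tree and is zero, so the chord coefficients determine a cycle.\<close>

theorem h1_Euler:
  assumes G: "fin_digraph G" and ne: "verts G \<noteq> {}"
    and cut: "\<And>W. W \<noteq> {} \<Longrightarrow> W \<subset> verts G \<Longrightarrow> \<exists>e\<in>arcs G. (tail G e \<in> W) \<noteq> (head G e \<in> W)"
  shows "h1 G + card (verts G) = card (arcs G) + 1"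
proof -
  interpret fin_digraph G by (rule G)
  interpret frag: module "frag_cmul :: int \<Rightarrow> ('b \<Rightarrow>\<^sub>0 int) \<Rightarrow> _" by (rule module_frag_cmul)
  obtain F where F: "F \<subseteq> arcs G" "card F + 1 = card (verts G)"
    and acyc: "\<And>c. Poly_Mapping.keys c \<subseteq> F \<Longrightarrow> boundary G c = 0 \<Longrightarrow> c = 0"
    and path: "\<And>u v. u \<in> verts G \<Longrightarrow> v \<in> verts G \<Longrightarrow>
       \<exists>p. Poly_Mapping.keys p \<subseteq> F \<and> boundary G p = frag_of v - frag_of u"
    using spanning_tree_exists[OF G ne cut] by blast
  define S where "S = arcs G - F"
  have S: "finite S" "card S + card F = card (arcs G)"
    using F by (auto simp: S_def card_Diff_subset finite_subset card_mono)
  have "\<exists>p. Poly_Mapping.keys p \<subseteq> F \<and> boundary G p = frag_of (head G e) - frag_of (tail G e)"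
    if "e \<in> S" for e
    using that by (intro path) (auto simp: S_def)
  then obtain p where p: "\<And>e. e \<in> S \<Longrightarrow> Poly_Mapping.keys (p e) \<subseteq> F"
    "\<And>e. e \<in> S \<Longrightarrow> boundary G (p e) = frag_of (head G e) - frag_of (tail G e)"
    by metis
  \<comment> \<open>The fundamental cycle of \<open>e\<close>: the chord closed up by the tree chain
    with the same boundary.\<close>
  define z where "z e = frag_of e - p e" for e
  have lookup_z: "poly_mapping.lookup (z e) e' = of_bool (e = e')" if "e \<in> S" "e' \<in> S" for e e'
    using p(1)[OF that(1)] that by (auto simp: z_def lookup_minus S_def in_keys_iff)
  have z_H1: "z ` S \<subseteq> H1 G"
  proof
    fix x assume "x \<in> z ` S"
    then obtain e where e: "e \<in> S" "x = z e" by blast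
    then show "x \<in> H1 G"
      using p[OF e(1)] F Poly_Mapping.keys_diff[of "frag_of e" "p e"]
      by (auto simp: H1_def z_def keys_frag_of S_def)
  qed
  have inj_z: "inj_on z S"
  proof (rule inj_onI)
    fix x y assume xy: "x \<in> S" "y \<in> S" "z x = z y"
    have "of_bool (x = x) = (of_bool (y = x) :: int)"
      unfolding lookup_z[OF xy(1,1), symmetric] lookup_z[OF xy(2,1), symmetric] xy(3) ..
    then show "x = y" by (simp split: if_splits)
  qed
  have "frag.independent (z ` S)"
  proof
    assume "frag.dependent (z ` S)"
    then obtain u e where u: "e \<in> S" "u (z e) \<noteq> 0" "(\<Sum>v\<in>z ` S. frag_cmul (u v) v) = 0"
      using S by (auto simp: frag.dependent_finite)
    have "0 = poly_mapping.lookup (\<Sum>x\<in>S. frag_cmul (u (z x)) (z x)) e"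
      using u inj_z by (simp add: sum.reindex)
    also have "\<dots> = (\<Sum>x\<in>S. if x = e then u (z x) else 0)"
      unfolding lookup_frag_sum using u by (intro sum.cong) (auto simp: lookup_z)
    also have "\<dots> = u (z e)" using S u by simp
    finally show False using u by simp
  qed
  then have ex: "card S \<in> {card B |B. finite B \<and> B \<subseteq> H1 G \<and> frag.independent B}"
    using z_H1 S card_image[OF inj_z] by (intro CollectI exI[of _ "z ` S"]) auto
  \<comment> \<open>With more cycles than chords, some nontrivial combination has all chord
    coefficients zero; it lies on the tree, hence vanishes, which is a dependence.\<close>
  have "card B \<le> card S" if B: "finite B" "B \<subseteq> H1 G" "frag.independent B" for B
  proof (rule ccontr)
    assume "\<not> card B \<le> card S"
    then obtain a where a: "\<exists>b\<in>B. a b \<noteq> 0"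
        "\<And>s. s \<in> S \<Longrightarrow> (\<Sum>b\<in>B. a b * poly_mapping.lookup b s) = 0"
      using homogeneous_system_nontrivial_solution[of S B poly_mapping.lookup] B S by auto
    define x where "x = (\<Sum>b\<in>B. frag_cmul (a b) b)"
    have "boundary G x = 0"
      using B by (auto simp: x_def boundary_sum H1_def intro!: sum.neutral)
    moreover have "Poly_Mapping.keys x \<subseteq> F"
    proof
      fix e assume e: "e \<in> Poly_Mapping.keys x"
      then obtain b where "b \<in> B" "e \<in> Poly_Mapping.keys b"
        using keys_sum[of "\<lambda>b. frag_cmul (a b) b" B] unfolding x_def by auto
      then have "e \<in> arcs G" using B by (auto simp: H1_def)
      moreover have "e \<notin> S"
        using e a by (auto simp: x_def in_keys_iff lookup_frag_sum)
      ultimately show "e \<in> F" by (simp add: S_def)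
    qed
    ultimately have "x = 0" using acyc by blast
    then show False
      using a B unfolding x_def by (auto simp: frag.dependent_finite)
  qed
  then have "h1 G = card S"
    unfolding h1_def Z_rank_def using ex by (intro cSup_eq_maximum) auto
  then show ?thesis using S F by simp
qed

text \<open>If no arc left \<open>W\<close>, membership in \<open>W\<close> would propagate along an
  undirected walk from a vertex inside to one outside.\<close>

lemma connected_imp_cut_arc:
  assumes "Digraph_Component.connected G" "W \<noteq> {}" "W \<subset> verts G"
  shows "\<exists>e\<in>arcs G. (tail G e \<in> W) \<noteq> (head G e \<in> W)"
proof (rule ccontr)
  assume no: "\<not> ?thesis"
  obtain u v where uv: "u \<in> W" "v \<in> verts G" "v \<notin> W" using assms by blast
  then have "u \<rightarrow>\<^sup>*\<^bsub>with_proj (mk_symmetric G)\<^esub> v"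
    using assms by (auto simp: connected_def strongly_connected_def)
  then have "(u, v) \<in> (parcs (mk_symmetric G))\<^sup>*"
    using reachable_rtranclI by fastforce
  then have "v \<in> W"
    by (induction rule: rtrancl_induct) (use uv no in \<open>auto simp: parcs_mk_symmetric\<close>)
  with uv show False by blast
qed

section \<open>Sparsity from an elimination ordering\<close>

text \<open>Each edge is counted at its higher end. The lowest vertex \<open>x\<close> receives
  none. The next vertex \<open>y\<close> receives at most one, because its only possible lower
  neighbour is \<open>x\<close> and there are no parallel edges. All others receive at most two, so
  m \<le> 1 + 2(n - 2). Equality leaves no slack at any vertex.\<close>

lemma elimination_order_sparse:
  fixes rk :: "'v \<Rightarrow> 'a :: linorder"
  assumes fin: "finite X" and X2: "2 \<le> card X"
    and finA: "finite A" and ends: "lo ` A \<subseteq> X" "hi ` A \<subseteq> X"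
    and less: "\<And>e. e \<in> A \<Longrightarrow> rk (lo e) < rk (hi e)"
    and two: "\<And>v. v \<in> X \<Longrightarrow> card {e \<in> A. hi e = v} \<le> 2"
    and simple: "\<And>v. v \<in> X \<Longrightarrow> inj_on lo {e \<in> A. hi e = v}"
  obtains x y where "x \<in> X" "y \<in> X" "x \<noteq> y"
    "\<And>v. v \<in> X \<Longrightarrow> rk x \<le> rk v" "\<And>v. v \<in> X \<Longrightarrow> v \<noteq> x \<Longrightarrow> rk y \<le> rk v"
    "card A + 3 \<le> 2 * card X"
    "card A + 3 = 2 * card X \<Longrightarrow> \<exists>e\<in>A. hi e = y \<and> lo e = x"
    "\<And>v. card A + 3 = 2 * card X \<Longrightarrow> v \<in> X - {x, y} \<Longrightarrow> card {e \<in> A. hi e = v} = 2"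
proof -
  define d where "d v = card {e \<in> A. hi e = v}" for v
  have "X \<noteq> {}" using X2 by auto
  then obtain x where x: "x \<in> X" "\<And>v. v \<in> X \<Longrightarrow> rk x \<le> rk v"
    using arg_min_if_finite(1)[OF fin, of rk] arg_min_least[OF fin, of _ rk] by blast
  have "X - {x} \<noteq> {}"
  proof
    assume "X - {x} = {}"
    then have "X = {x}" using x by blast
    then show False using X2 by simp
  qed
  then obtain y where y: "y \<in> X - {x}" "\<And>v. v \<in> X - {x} \<Longrightarrow> rk y \<le> rk v"
    using arg_min_if_finite(1)[of "X - {x}" rk] arg_min_least[of "X - {x}" _ rk] fin by blast
  have dx: "d x = 0"
    using x(2) less ends finA by (fastforce simp: d_def)
  have ey: "lo e = x" if "e \<in> A" "hi e = y" for e
    using y(2)[of "lo e"] less[OF that(1)] that ends by force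
  have dy: "d y \<le> 1"
  proof -
    have "e = f" if "e \<in> A" "hi e = y" "f \<in> A" "hi f = y" for e f
      using inj_onD[OF simple[of y], of e f] ey that y(1) by auto
    then show ?thesis by (auto simp: d_def card_le_Suc0_iff_eq finA)
  qed
  define Y where "Y = X - {x, y}"
  have XY: "X = insert x (insert y Y)" "x \<notin> insert y Y" "y \<notin> Y" "finite Y"
    using x y fin by (auto simp: Y_def)
  have cX: "card X = card Y + 2"
    using XY by simp
  have "card A = (\<Sum>v\<in>X. d v)"
    unfolding d_def using sum.group[OF finA fin ends(2), of "\<lambda>_. 1 :: nat"] by simp
  then have cA: "card A = d y + (\<Sum>v\<in>Y. d v)"
    using XY dx by simp
  have d2: "d v \<le> 2" if "v \<in> Y" for v
    using two[of v] that by (auto simp: d_def Y_def)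
  have sumY: "(\<Sum>v\<in>Y. d v) \<le> 2 * card Y"
    using sum_bounded_above[of Y d 2] d2 by simp
  show ?thesis
  proof
    show "x \<in> X" "y \<in> X" "x \<noteq> y" using x y by auto
    show "\<And>v. v \<in> X \<Longrightarrow> rk x \<le> rk v" by (rule x)
    show "\<And>v. v \<in> X \<Longrightarrow> v \<noteq> x \<Longrightarrow> rk y \<le> rk v" using y by blast
    show "card A + 3 \<le> 2 * card X" using cA cX sumY dy by simp
  next
    assume eq: "card A + 3 = 2 * card X"
    then have "d y = 1" using cA cX sumY dy by simp
    then have "{e \<in> A. hi e = y} \<noteq> {}" unfolding d_def by (metis card.empty zero_neq_one)
    then show "\<exists>e\<in>A. hi e = y \<and> lo e = x" using ey by blast
  next
    fix v assume eq: "card A + 3 = 2 * card X" and v: "v \<in> X - {x, y}"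
    have tot: "(\<Sum>v\<in>Y. d v) = 2 * card Y" using eq cA cX sumY dy by simp
    have vY: "v \<in> Y" using v by (simp add: Y_def)
    show "card {e \<in> A. hi e = v} = 2"
    proof (rule ccontr)
      assume "card {e \<in> A. hi e = v} \<noteq> 2"
      then have "d v < 2" using d2[OF vY] by (simp add: d_def)
      then have "(\<Sum>v\<in>Y. d v) < (\<Sum>v\<in>Y. 2)"
        using d2 vY XY(4) by (intro sum_strict_mono_ex1) auto
      with tot show False by simp
    qed
  qed
qed

section \<open>Generalized zigzag graphs\<close>

text \<open>
  Order the vertices as \<open>u\<^sub>1, u\<^sub>2, v\<^sub>1\<^sub>1, v\<^sub>1\<^sub>2, \<dots>, u\<^sub>3, v\<^sub>2\<^sub>1, \<dots>, u\<^sub>t\<^sub>+\<^sub>2\<close>.  Apart from the closing edge, each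
  vertex from the third on is joined to exactly two earlier ones.
\<close>

fun gzz_rank :: "gzz_vertex \<Rightarrow> nat \<times> nat" where
  "gzz_rank (U k) = (k, 0)"
| "gzz_rank (V i j) = (i + 1, j)"

text \<open>On a spoke the ends are swapped against \<open>gzz_tail\<close> and
  \<open>gzz_head\<close>, since v_ij comes after u_(i+1) in the order. The closing edge stays
  outside the count and gets a dummy value.\<close>

fun gzz_later :: "(nat \<Rightarrow> nat) \<Rightarrow> gzz_edge \<Rightarrow> gzz_vertex" where
  "gzz_later l (Spine i) = U (i + 1)"
| "gzz_later l (Side i j) = side_vertex l i (j + 1)"
| "gzz_later l (Spoke i j) = V i j"
| "gzz_later l Closing = undefined"

fun gzz_earlier :: "(nat \<Rightarrow> nat) \<Rightarrow> gzz_edge \<Rightarrow> gzz_vertex" where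
  "gzz_earlier l (Spine i) = U i"
| "gzz_earlier l (Side i j) = side_vertex l i j"
| "gzz_earlier l (Spoke i j) = U (i + 1)"
| "gzz_earlier l Closing = undefined"

lemma gzz_rank_less:
  assumes "e \<in> arcs (GZZ t l)" "e \<noteq> Closing"
  shows "gzz_rank (gzz_earlier l e) < gzz_rank (gzz_later l e)"
  using assms by (auto simp: GZZ_def side_vertex_def)

lemma gzz_ends:
  assumes "e \<noteq> Closing"
  shows "{gzz_earlier l e, gzz_later l e} = {tail (GZZ t l) e, head (GZZ t l) e}"
  using assms by (cases e) (auto simp: GZZ_def)

lemma gzz_arcs_with_later_U2:
  assumes "e \<in> arcs (GZZ t l)" "e \<noteq> Closing" "gzz_later l e = U 2"
  shows "e = Spine 1"
  using assms by (auto simp: GZZ_def side_vertex_def split: if_splits)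

lemma gzz_arcs_with_earlier_U1:
  assumes "e \<in> arcs (GZZ t l)" "e \<noteq> Closing" "gzz_earlier l e = U 1"
  shows "e = Spine 1 \<or> e = Side 1 0"
  using assms by (auto simp: GZZ_def side_vertex_def split: if_splits)

text \<open>For \<open>u\<^sub>1\<close> and \<open>u\<^sub>2\<close> this set contains names that are not edges of the graph.\<close>

definition gzz_later_arcs :: "(nat \<Rightarrow> nat) \<Rightarrow> gzz_vertex \<Rightarrow> gzz_edge set" where
  "gzz_later_arcs l v = (case v of U k \<Rightarrow> {Spine (k - 1), Side (k - 2) (l (k - 2) - 1)}
                                 | V i j \<Rightarrow> {Side i (j - 1), Spoke i j})"

text \<open>An inclusion suffices: it bounds the count by two in every subgraph, and if a subgraph
  attains two, its arcs there are the whole set.\<close>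

lemma gzz_later_arcs_superset:
  "{e \<in> arcs (GZZ t l) - {Closing}. gzz_later l e = v} \<subseteq> gzz_later_arcs l v"
  by (cases v) (auto simp: gzz_later_arcs_def GZZ_def side_vertex_def split: if_splits)

lemma card_gzz_later_arcs: "finite (gzz_later_arcs l v)" "card (gzz_later_arcs l v) = 2"
  by (simp_all add: gzz_later_arcs_def split: gzz_vertex.split)

text \<open>No parallel edges: a spine edge or spoke starts at a u-vertex different from the
  preceding vertex on the side path.\<close>

lemma inj_on_gzz_earlier:
  "inj_on (gzz_earlier l) {e \<in> arcs (GZZ t l) - {Closing}. gzz_later l e = v}"
proof (rule inj_onI)
  fix e f
  assume "e \<in> {e \<in> arcs (GZZ t l) - {Closing}. gzz_later l e = v}"
    and "f \<in> {e \<in> arcs (GZZ t l) - {Closing}. gzz_later l e = v}"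
    and "gzz_earlier l e = gzz_earlier l f"
  then show "e = f"
    by (cases e; cases f) (auto simp: GZZ_def side_vertex_def split: if_splits)
qed

section \<open>Edge count and connectedness of the zigzag graph\<close>

lemma card_UN_injective_images:
  assumes "\<And>i j i' j'. f i j = f i' j' \<longleftrightarrow> i = i' \<and> j = j'" "finite I" "\<And>i. finite (S i)"
  shows "card (\<Union>i\<in>I. f i ` S i) = (\<Sum>i\<in>I. card (S i))"
  using assms by (subst card_UN_disjoint) (auto simp: card_image inj_on_def)

lemma card_arcs_GZZ:
  assumes "\<And>i. 1 \<le> i \<Longrightarrow> i \<le> t \<Longrightarrow> l i \<ge> 1"
  shows "card (arcs (GZZ t l)) + 2 = 2 * card (verts (GZZ t l))"
proof -
  have v: "verts (GZZ t l) = U ` {1..t + 2} \<union> (\<Union>i\<in>{1..t}. V i ` {1..<l i})"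
    by (auto simp: GZZ_def)
  have a: "arcs (GZZ t l) = insert Closing (Spine ` {1..t + 1} \<union>
      ((\<Union>i\<in>{1..t}. Side i ` {0..<l i}) \<union> (\<Union>i\<in>{1..t}. Spoke i ` {1..<l i})))"
    by (auto simp: GZZ_def)
  have "card (verts (GZZ t l)) = (t + 2) + (\<Sum>i=1..t. l i - 1)"
    unfolding v by (subst card_Un_disjoint) (auto simp: card_UN_injective_images card_image inj_on_def)
  moreover have "card (arcs (GZZ t l)) = Suc ((t + 1) + ((\<Sum>i=1..t. l i) + (\<Sum>i=1..t. l i - 1)))"
    unfolding a
    by (subst card_insert_disjoint, auto)+
      (subst card_Un_disjoint, auto simp: card_UN_injective_images card_image inj_on_def)+
  \<comment> \<open>Subtraction is truncated, so \<open>l i \<ge> 1\<close> is what allows the shift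
    by one in each summand.\<close>
  moreover have "(\<Sum>i=1..t. l i) = (\<Sum>i=1..t. (l i - 1) + 1)"
  proof (rule sum.cong)
    show "l i = (l i - 1) + 1" if "i \<in> {1..t}" for i
      using assms[of i] that by simp
  qed simp
  then have "(\<Sum>i=1..t. l i) = (\<Sum>i=1..t. l i - 1) + t"
    by (simp only: sum.distrib) simp
  ultimately show ?thesis by simp
qed

text \<open>The spine joins all u-vertices, and a spoke joins each v_ij to the spine; a set left by
  no edge thus contains all vertices or none.\<close>

lemma gzz_cut_arc:
  assumes W: "W \<noteq> {}" "W \<subset> verts (GZZ t l)"
  shows "\<exists>e\<in>arcs (GZZ t l). (tail (GZZ t l) e \<in> W) \<noteq> (head (GZZ t l) e \<in> W)"
proof (rule ccontr)
  assume no: "\<not> ?thesis"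
  have spine: "U k \<in> W \<longleftrightarrow> U 1 \<in> W" if "1 \<le> k" "k \<le> t + 2" for k
    using that
  proof (induction k rule: dec_induct)
    case (step n)
    then have "Spine n \<in> arcs (GZZ t l)" by (auto simp: GZZ_def)
    with no have "tail (GZZ t l) (Spine n) \<in> W \<longleftrightarrow> head (GZZ t l) (Spine n) \<in> W" by blast
    then show ?case using step by (simp add: GZZ_def)
  qed simp
  have "v \<in> W \<longleftrightarrow> U 1 \<in> W" if v: "v \<in> verts (GZZ t l)" for v
  proof (cases v)
    case (U k)
    then show ?thesis using v spine[of k] by (auto simp: GZZ_def)
  next
    case (V i j)
    then have ij: "1 \<le> i" "i \<le> t" and "Spoke i j \<in> arcs (GZZ t l)"
      using v by (auto simp: GZZ_def)
    with no have "tail (GZZ t l) (Spoke i j) \<in> W \<longleftrightarrow> head (GZZ t l) (Spoke i j) \<in> W" by blast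
    then show ?thesis using V ij spine[of "i + 1"] by (simp add: GZZ_def)
  qed
  with W show False by blast
qed

text \<open>The elimination order gives the bound without the closing edge. Adding that edge costs
  one, so it must be shown that a subgraph with the closing edge is not tight.\<close>

lemma gzz_sparse:
  assumes l: "\<And>i. 1 \<le> i \<Longrightarrow> i \<le> t \<Longrightarrow> l i \<ge> 1" and l1: "l 1 \<ge> 2"
    and A: "A \<noteq> {}" "A \<subset> arcs (GZZ t l)"
  shows "card A + 3 \<le> 2 * card (tail (GZZ t l) ` A \<union> head (GZZ t l) ` A)"
proof -
  interpret fin_digraph "GZZ t l" by (rule fin_digraph_GZZ)
  define X where "X = tail (GZZ t l) ` A \<union> head (GZZ t l) ` A"
  define A' where "A' = A - {Closing}"
  have finA: "finite A" using A finite_subset[OF _ finite_arcs] by blast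
  have Xv: "X \<subseteq> verts (GZZ t l)" using A by (auto simp: X_def)
  have X: "finite X" using finA by (simp add: X_def)
  have A'arc: "e \<in> arcs (GZZ t l)" "e \<noteq> Closing" if "e \<in> A'" for e
    using that A by (auto simp: A'_def)
  have ends: "gzz_earlier l e \<in> X" "gzz_later l e \<in> X" if "e \<in> A'" for e
    using gzz_ends[OF A'arc(2)[OF that], of l t] that by (auto simp: X_def A'_def doubleton_eq_iff)
  have closing: "U 1 \<in> X" "U (t + 2) \<in> X" if "Closing \<in> A"
    using that by (force simp: X_def GZZ_def image_iff)+
  obtain p q where "p \<in> X" "q \<in> X" "p \<noteq> q"
  proof (cases "Closing \<in> A")
    case True
    then show ?thesis using that[OF closing] by simp
  next
    case False
    then obtain e where "e \<in> A'" using A by (auto simp: A'_def)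
    then show ?thesis
      using that[OF ends] gzz_rank_less[OF A'arc] by fastforce
  qed
  then have X2: "2 \<le> card X"
    using card_mono[OF X, of "{p, q}"] by simp
  have sub: "{e \<in> A'. gzz_later l e = v} \<subseteq> {e \<in> arcs (GZZ t l) - {Closing}. gzz_later l e = v}" for v
    using A'arc by blast
  have sub': "{e \<in> A'. gzz_later l e = v} \<subseteq> gzz_later_arcs l v" for v
    using sub gzz_later_arcs_superset by blast
  have two: "card {e \<in> A'. gzz_later l e = v} \<le> 2" for v
    using card_mono[OF card_gzz_later_arcs(1) sub'] by (simp add: card_gzz_later_arcs)
  obtain x y where xy: "x \<in> X" "y \<in> X" "x \<noteq> y"
      and x_min: "\<And>v. v \<in> X \<Longrightarrow> gzz_rank x \<le> gzz_rank v"
      and y_min: "\<And>v. v \<in> X \<Longrightarrow> v \<noteq> x \<Longrightarrow> gzz_rank y \<le> gzz_rank v"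
      and bound: "card A' + 3 \<le> 2 * card X"
      and tight_y: "card A' + 3 = 2 * card X \<Longrightarrow> \<exists>e\<in>A'. gzz_later l e = y \<and> gzz_earlier l e = x"
      and tight: "\<And>v. card A' + 3 = 2 * card X \<Longrightarrow> v \<in> X - {x, y} \<Longrightarrow>
                    card {e \<in> A'. gzz_later l e = v} = 2"
  proof (rule elimination_order_sparse[of X A' "gzz_earlier l" "gzz_later l" gzz_rank])
    show "inj_on (gzz_earlier l) {e \<in> A'. gzz_later l e = v}" for v
      using inj_on_gzz_earlier sub by (rule inj_on_subset)
    show "gzz_rank (gzz_earlier l e) < gzz_rank (gzz_later l e)" if "e \<in> A'" for e
      using gzz_rank_less[OF A'arc[OF that]] .
    show "finite A'" using finA by (simp add: A'_def)
  qed (use X X2 ends two in auto)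
  have "card A' + 3 \<noteq> 2 * card X" if c: "Closing \<in> A"
  proof
    assume eq: "card A' + 3 = 2 * card X"
    \<comment> \<open>In the tight case the two arcs counted at \<open>v\<close> exhaust the
      two-element set \<open>gzz_later_arcs l v\<close>.\<close>
    have full: "gzz_later_arcs l v \<subseteq> A'" if "v \<in> X - {x, y}" for v
      using card_subset_eq[OF card_gzz_later_arcs(1) sub', of v] tight[OF eq that]
      by (auto simp: card_gzz_later_arcs)
    have X_cases: "(\<exists>k. v = U k \<and> 1 \<le> k) \<or> (\<exists>i j. v = V i j \<and> 1 \<le> i \<and> 1 \<le> j)" if "v \<in> X" for v
      using that Xv by (auto simp: GZZ_def)
    have x: "x = U 1"
      using X_cases[OF xy(1)] x_min[OF closing(1)[OF c]] by auto
    have U2: "U 2 \<in> X"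
    proof (rule ccontr)
      assume n2: "U 2 \<notin> X"
      obtain e where e: "e \<in> A'" "gzz_later l e = y" "gzz_earlier l e = x"
        using tight_y[OF eq] by blast
      then have "e = Side 1 0"
        using gzz_arcs_with_earlier_U1[of e t l] A'arc xy n2 x by (auto simp: numeral_2_eq_2)
      \<comment> \<open>Since \<open>l 1 \<ge> 2\<close>, the first edge of the side path from u_1
        ends at v_11 and not yet at u_3.\<close>
      then have y: "y = V 1 1" using e l1 by (simp add: side_vertex_def)
      \<comment> \<open>The next vertex in the order must be joined to both \<open>u\<^sub>1\<close> and \<open>v\<^sub>1\<^sub>1\<close>, but no vertex is.\<close>
      define Y where "Y = X - {x, y}"
      have "finite Y" "Y \<noteq> {}" using X closing(2)[OF c] x y by (auto simp: Y_def)
      then obtain z where z: "z \<in> Y" "\<And>v. v \<in> Y \<Longrightarrow> gzz_rank z \<le> gzz_rank v"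
        using arg_min_if_finite(1)[of Y gzz_rank] arg_min_least[of Y _ gzz_rank] by blast
      have zA: "{e \<in> A'. gzz_later l e = z} = gzz_later_arcs l z"
        using card_subset_eq[OF card_gzz_later_arcs(1) sub', of z] tight[OF eq, of z] z(1)
        by (auto simp: card_gzz_later_arcs Y_def)
      have early: "gzz_earlier l f \<in> {U 1, V 1 1}" if "f \<in> gzz_later_arcs l z" for f
      proof -
        have f: "f \<in> A'" "gzz_later l f = z" using that zA by auto
        then have "\<not> gzz_rank z \<le> gzz_rank (gzz_earlier l f)"
          using gzz_rank_less[OF A'arc(1,2)[OF f(1)]] by auto
        then have "gzz_earlier l f \<notin> Y" using z(2) by blast
        then show ?thesis using ends(1)[OF f(1)] by (auto simp: Y_def x y)
      qed
      have zX: "z \<in> X" using z by (simp add: Y_def)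
      show False
      proof (cases z)
        case (U k)
        then have "k - 1 = 1" using early[of "Spine (k - 1)"] by (simp add: gzz_later_arcs_def)
        then have "k = 2" by simp
        then show False using U zX n2 by simp
      next
        case (V i j)
        then have "i = 0" using early[of "Spoke i j"] by (simp add: gzz_later_arcs_def)
        then show False using V X_cases[OF zX] by simp
      qed
    qed
    then have y: "y = U 2"
      using y_min[OF U2] X_cases[OF xy(2)] xy x by auto
    \<comment> \<open>Descent along the spine from u_(t+2), which is present as an end of the
      closing edge.\<close>
    have U_X: "U k \<in> X" if "2 \<le> k" "k \<le> t + 2" for k
      using that(2,1)
    proof (induction k rule: inc_induct)
      case base
      show ?case using closing(2)[OF c] by simp
    next
      case (step n)
      then have "U (Suc n) \<in> X - {x, y}" by (auto simp: x y)
      from full[OF this] have "Spine n \<in> A'" by (simp add: gzz_later_arcs_def)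
      from ends(1)[OF this] show ?case by simp
    qed
    \<comment> \<open>Descent along each side path from u_(i+2). The vertex at position
      \<open>Suc j\<close> is neither u_1 nor u_2, so its two earlier arcs are present.\<close>
    have side: "side_vertex l i j \<in> X" if i: "1 \<le> i" "i \<le> t" and "j \<le> l i" for i j
      using \<open>j \<le> l i\<close>
    proof (induction j rule: inc_induct)
      case base
      then show ?case using U_X[of "i + 2"] l[OF i] i by (simp add: side_vertex_def)
    next
      case (step j)
      then have "side_vertex l i (Suc j) \<in> X - {x, y}"
        using i by (auto simp: side_vertex_def x y)
      moreover have "Side i j \<in> arcs (GZZ t l)" using step i by (simp add: GZZ_def)
      then have "Side i j \<in> gzz_later_arcs l (side_vertex l i (Suc j))"
        using gzz_later_arcs_superset[of t l "side_vertex l i (Suc j)"] by auto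
      ultimately have "Side i j \<in> A'" using full by blast
      from ends(1)[OF this] show ?case by simp
    qed
    have "e \<in> A" if e: "e \<in> arcs (GZZ t l)" for e
    \<comment> \<open>\<open>Spine 1\<close> is separate because its later end is \<open>y\<close>,
      where \<open>full\<close> says nothing; there tightness supplies one arc, and
      \<open>Spine 1\<close> is the only candidate.\<close>
    proof (cases "e = Closing \<or> e = Spine 1")
      case True
      obtain f where "f \<in> A'" "gzz_later l f = U 2" using tight_y[OF eq] y by blast
      then have "Spine 1 \<in> A" using gzz_arcs_with_later_U2[OF A'arc] by (auto simp: A'_def)
      with True c show ?thesis by blast
    next
      case False
      have V_X: "V i j \<in> X" if "i \<in> {1..t}" "j \<in> {1..<l i}" for i j
        using side[of i j] that by (auto simp: side_vertex_def)
      have "gzz_later l e \<in> X"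
        using e False U_X side V_X by (cases e) (auto simp: GZZ_def)
      moreover have "gzz_later l e \<noteq> U 1"
        using e False by (cases e) (auto simp: GZZ_def side_vertex_def)
      moreover have "gzz_later l e \<noteq> U 2"
        using gzz_arcs_with_later_U2[OF e] False by auto
      ultimately have "gzz_later_arcs l (gzz_later l e) \<subseteq> A'"
        using full by (simp add: x y)
      then have "e \<in> A'"
        using gzz_later_arcs_superset[of t l "gzz_later l e"] e False by blast
      then show ?thesis by (simp add: A'_def)
    qed
    with A show False by blast
  qed
  then show ?thesis
    using bound finA unfolding A'_def X_def[symmetric] by (cases "Closing \<in> A") auto
qed

theorem theorem2p2p5:
  fixes t :: nat and l :: "nat \<Rightarrow> nat"
  assumes "t \<ge> 1"
    and "\<And>i. 1 \<le> i \<Longrightarrow> i \<le> t \<Longrightarrow> l i \<ge> 1"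
    and "l 1 \<ge> 2"
    and "l t \<ge> 2"
  shows "primitively_log_divergent (GZZ t l)"
  unfolding primitively_log_divergent_def
proof (intro conjI allI impI)
  have "verts (GZZ t l) \<noteq> {}" by (simp add: GZZ_def)
  then have "h1 (GZZ t l) + card (verts (GZZ t l)) = card (arcs (GZZ t l)) + 1"
    using fin_digraph_GZZ gzz_cut_arc by (intro h1_Euler)
  then show "log_divergent (GZZ t l)"
    using card_arcs_GZZ[of t l] assms(2) by (simp add: log_divergent_def)
next
  fix A
  assume A: "A \<noteq> {} \<and> A \<subset> arcs (GZZ t l)
    \<and> Digraph_Component.connected (edge_subgraph (GZZ t l) A)"
  let ?H = "edge_subgraph (GZZ t l) A"
  have "finite A"
    using A finite_subset[OF _ fin_digraph.finite_arcs[OF fin_digraph_GZZ]] by blast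
  then have "fin_digraph ?H"
    by unfold_locales (auto simp: edge_subgraph_def)
  moreover have "verts ?H \<noteq> {}" using A by (simp add: edge_subgraph_def)
  ultimately have "h1 ?H + card (verts ?H) = card (arcs ?H) + 1"
    using A by (intro h1_Euler connected_imp_cut_arc) auto
  moreover have "card A + 3 \<le> 2 * card (verts ?H)"
    using gzz_sparse[of t l A] assms A by (simp add: edge_subgraph_def)
  \<comment> \<open>With h_1 = m - n + 1 and m + 3 \<le> 2n, twice h_1 is at most m - 1.\<close>
  ultimately show "convergent_graph ?H"
    by (simp add: convergent_graph_def edge_subgraph_def)
qed

end
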